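(* Let $\mathcal S$ be a local approximation class in $\mathbb{R}^n$, let $A\subseteq\mathbb{R}^n$ be nonempty and let $\varepsilon\geq0$. The following are equivalent: (i) $A$ is locally $\varepsilon'$-approximable by $\mathcal S$ for all $\varepsilon'>\varepsilon$; (ii) $\Psi\text{-}\mathrm{Tan}(\overline A,x)\subseteq(\mathcal S;\varepsilon)^\Theta_{0,\infty}$ for all $x\in A$; (iii) $\Psi\text{-}\mathrm{Tan}(\overline A,x)\subseteq(\mathcal S;\varepsilon)^\Theta_{\mathbb{R}^n,\infty}$ for all $x\in A$.
   Context: $B(x,r)$ denotes the closed ball in $\mathbb{R}^n$ and $\overline A$ the closure of $A$. $\mathfrak C(0)$ is the collection of closed subsets of $\mathbb{R}^n$ containing $0$. For $A,B\subseteq\mathbb{R}^n$ with $B\neq\emptyset$, $\mathrm{ex}(A,B)=\sup_{a\in A}\inf_{b\in B}|a-b|$, with $\mathrm{ex}(\emptyset,B)=0$. Nonempty closed sets $A_i$ converge to a nonempty closed set $A$ (Attouch--Wets topology), $A_i\to A$, if $\mathrm{ex}(A_i\cap B(0,r),A)\to0$ and $\mathrm{ex}(A\cap B(0,r),A_i)\to 0$ for all $r>0$. A local approximation class is a nonempty collection $\mathcal S\subseteq\mathfrak C(0)$ such that $\lambda S\in\mathcal S$ for all $S\in\mathcal S$, $\lambda>0$. For nonempty $A,B$ put $\widetilde{\mathrm D}^{x,r}[A,B]=\frac1r\max\{\mathrm{ex}(A\cap B(x,r),B),\mathrm{ex}(B\cap B(x,r),A)\}$, and $\Theta^{\mathcal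 S}_A(x,r)=\inf_{S\in\mathcal S}\widetilde{\mathrm D}^{x,r}[A,x+S]$. A nonempty set $A$ is locally $\varepsilon$-approximable by $\mathcal S$ if for every compact $K\subseteq A$ there is $r_K>0$ such that $\Theta^{\mathcal S}_A(x,r)\leq\varepsilon$ for all $x\in K$ and $0<r\leq r_K$. Enlargements: $(\mathcal S;\varepsilon)^\Theta_{0,\infty}=\{D\in\mathfrak C(0):\Theta^{\mathcal S}_D(0,r)\leq\varepsilon\text{ for all }r>0\}$ and $(\mathcal S;\varepsilon)^\Theta_{\mathbb{R}^n,\infty}=\{D\in\mathfrak C(0):\Theta^{\mathcal S}_D(x,r)\leq\varepsilon\text{ for all }x\in D\text{ and all }r>0\}$. For closed $A$ and $x\in A$, $\Psi\text{-}\mathrm{Tan}(A,x)$ is the collection of $T\in\mathfrak C(0)$ for which there exist $x_i\in A$, $r_i>0$ with $x_i\to x$, $r_i\to0$ and $(A-x_i)/r_i\to T$. *)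

theory Defs
  imports "HOL-Analysis.Analysis"
begin

text \<open>
  The excess takes values in \<^typ>\<open>ennreal\<close>, so that the supremum may be infinite when \<open>A\<close>
  is unbounded; the supremum of the empty set is then 0, which gives \<open>excess {} B = 0\<close>.
  The function \<^const>\<open>infdist\<close> is the infimum of the distances only for \<open>B \<noteq> {}\<close>; the
  excess, and everything built on it below, is meant for nonempty \<open>B\<close> only.
\<close>

definition excess :: "'a::metric_space set \<Rightarrow> 'a set \<Rightarrow> ennreal" where
  "excess A B = (SUP a\<in>A. ennreal (infdist a B))"

definition aw_converges :: "(nat \<Rightarrow> 'a::real_normed_vector set) \<Rightarrow> 'a set \<Rightarrow> bool" where
  "aw_converges As A \<longleftrightarrow>
     (\<forall>r>0. (\<lambda>i. excess (As i \<inter> cball 0 r) A) \<longlonglongrightarrow> 0 \<and>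
            (\<lambda>i. excess (A \<inter> cball 0 r) (As i)) \<longlonglongrightarrow> 0)"

definition closed_zero_sets :: "'a::real_normed_vector set set" where
  "closed_zero_sets = {D. closed D \<and> 0 \<in> D}"

definition local_approximation_class :: "'a::real_normed_vector set set \<Rightarrow> bool" where
  "local_approximation_class \<S> \<longleftrightarrow>
     \<S> \<noteq> {} \<and> \<S> \<subseteq> closed_zero_sets \<and>
     (\<forall>S\<in>\<S>. \<forall>c>0. (\<lambda>y. c *\<^sub>R y) ` S \<in> \<S>)"

definition walkup_wets_dist ::
    "'a::real_normed_vector \<Rightarrow> real \<Rightarrow> 'a set \<Rightarrow> 'a set \<Rightarrow> ennreal" where
  "walkup_wets_dist x r A B =
     max (excess (A \<inter> cball x r) B) (excess (B \<inter> cball x r) A) / ennreal r"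

definition approximability ::
    "'a::real_normed_vector set set \<Rightarrow> 'a set \<Rightarrow> 'a \<Rightarrow> real \<Rightarrow> ennreal" where
  "approximability \<S> A x r = (INF S\<in>\<S>. walkup_wets_dist x r A ((\<lambda>y. x + y) ` S))"

definition locally_approximable ::
    "'a::real_normed_vector set set \<Rightarrow> real \<Rightarrow> 'a set \<Rightarrow> bool" where
  "locally_approximable \<S> \<epsilon> A \<longleftrightarrow>
     (\<forall>K. compact K \<and> K \<subseteq> A \<longrightarrow>
        (\<exists>r\<^sub>K>0. \<forall>x\<in>K. \<forall>r. 0 < r \<and> r \<le> r\<^sub>K \<longrightarrow> approximability \<S> A x r \<le> ennreal \<epsilon>))"

definition enlargement_at_zero ::
    "'a::real_normed_vector set set \<Rightarrow> real \<Rightarrow> 'a set set" where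
  "enlargement_at_zero \<S> \<epsilon> =
     {D \<in> closed_zero_sets. \<forall>r>0. approximability \<S> D 0 r \<le> ennreal \<epsilon>}"

definition enlargement_everywhere ::
    "'a::real_normed_vector set set \<Rightarrow> real \<Rightarrow> 'a set set" where
  "enlargement_everywhere \<S> \<epsilon> =
     {D \<in> closed_zero_sets. \<forall>x\<in>D. \<forall>r>0. approximability \<S> D x r \<le> ennreal \<epsilon>}"

definition pseudotangents :: "'a::real_normed_vector set \<Rightarrow> 'a \<Rightarrow> 'a set set" where
  "pseudotangents A x =
     {T \<in> closed_zero_sets. \<exists>xs rs.
        (\<forall>i. xs i \<in> A) \<and> (\<forall>i. rs i > 0) \<and> xs \<longlonglongrightarrow> x \<and> rs \<longlonglongrightarrow> 0 \<and>
        aw_converges (\<lambda>i. (\<lambda>y. (y - xs i) /\<^sub>R rs i) ` A) T}"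

end

theory Submission
  imports Defs "HOL-Complex_Analysis.Great_Picard"
begin

text \<open>
  Everything happens at the level of blow-ups \<open>(A - x) / s\<close>: since the class \<open>\<S>\<close> is closed
  under dilations, how well \<open>A\<close> is approximated in the ball of centre \<open>x\<close> and radius \<open>s * r\<close> is
  how well the blow-up is approximated in the ball of centre 0 and radius \<open>r\<close>
  (\<open>approximability_blowup_le_iff\<close>). Pseudotangents are the Attouch-Wets limits of
  blow-ups at shrinking scales, so passing between a set and its pseudotangents is a continuity
  question: if \<open>A\<close> and \<open>B\<close> are close in a large ball and \<open>A\<close> is well approximated in a ball slightly
  larger than the one of radius \<open>r\<close>, then \<open>B\<close> is almost as well approximated in the ball of radius
  \<open>r\<close> (\<open>approximability_transfer\<close>). This loses an arbitrarily small amount, which is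
  why local approximability is required for all \<open>\<epsilon>' > \<epsilon>\<close> only.

  If \<open>A\<close> is locally approximable and \<open>T\<close> is the limit of blow-ups at \<open>x\<^sub>i \<rightarrow> x\<close>, the points \<open>x\<^sub>i\<close>
  together with \<open>x\<close> form a compact set, on which the approximability bound is uniform, and it
  transfers from the blow-ups to \<open>T\<close>. This needs all \<open>x\<^sub>i\<close> to lie in \<open>A\<close>, not just in its
  closure; they can be moved into \<open>A\<close> by distances negligible against the scales, so that \<open>A\<close> and
  its closure have the same pseudotangents (\<open>pseudotangents_closure\<close>).

  Conversely, if \<open>A\<close> is not locally approximable, there are bad points \<open>x\<^sub>i\<close> in one compact subset
  of \<open>A\<close> and bad scales tending to 0. Every sequence of sets through the origin has an
  Attouch-Wets convergent subsequence (\<open>aw_compact\<close>), so a subsequence of the blow-ups converges to a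
  pseudotangent at a point of \<open>A\<close>; its approximability transfers back to the blow-ups, a
  contradiction.

  Finally, approximability of pseudotangents at the origin gives it at every point, because a
  pseudotangent recentred at one of its own points is again a pseudotangent
  (\<open>pseudotangents_translate\<close>): one moves the centres of the blow-ups accordingly.
\<close>

section \<open>Closeness of two sets in a ball\<close>

text \<open>
  The bound \<open>e\<close> on the excess of the part of \<open>A\<close> in a ball over \<open>B\<close>, phrased pointwise so that the
  estimates below are about real numbers instead of suprema in \<^typ>\<open>ennreal\<close>.
\<close>

definition half_near :: "'a::metric_space \<Rightarrow> real \<Rightarrow> real \<Rightarrow> 'a set \<Rightarrow> 'a set \<Rightarrow> bool" where
  "half_near x r e A B \<longleftrightarrow> (\<forall>a\<in>A \<inter> cball x r. infdist a B \<le> e)"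

definition near :: "'a::metric_space \<Rightarrow> real \<Rightarrow> real \<Rightarrow> 'a set \<Rightarrow> 'a set \<Rightarrow> bool" where
  "near x r e A B \<longleftrightarrow> half_near x r e A B \<and> half_near x r e B A"

lemma near_sym: "near x r e A B \<longleftrightarrow> near x r e B A"
  by (auto simp: near_def)

lemma half_near_mono:
  assumes "half_near x r e A B" "r' \<le> r" "e \<le> e'"
  shows "half_near x r' e' A B"
  using assms unfolding half_near_def by (meson IntD1 IntD2 IntI mem_cball order_trans)

lemma near_mono: "near x r e A B \<Longrightarrow> r' \<le> r \<Longrightarrow> e \<le> e' \<Longrightarrow> near x r' e' A B"
  unfolding near_def using half_near_mono by blast

lemma excess_le_iff:
  assumes "e \<ge> 0"
  shows "excess A B \<le> ennreal e \<longleftrightarrow> (\<forall>a\<in>A. infdist a B \<le> e)"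
  using assms by (simp add: excess_def SUP_le_iff ennreal_le_iff)

lemma half_near_iff_excess:
  "e \<ge> 0 \<Longrightarrow> half_near x r e A B \<longleftrightarrow> excess (A \<inter> cball x r) B \<le> ennreal e"
  by (simp add: half_near_def excess_le_iff)

lemma ennreal_divide_le_iff:
  assumes "r > 0" "e \<ge> 0"
  shows "z / ennreal r \<le> ennreal e \<longleftrightarrow> z \<le> ennreal (e * r)"
proof (cases z)
  case (real y)
  then show ?thesis
    using assms by (simp add: divide_ennreal ennreal_le_iff pos_divide_le_eq)
next
  case top
  then show ?thesis
    using assms by (simp add: ennreal_top_divide top_unique)
qed

lemma walkup_wets_dist_le_iff:
  assumes "r > 0" "e \<ge> 0"
  shows "walkup_wets_dist x r A B \<le> ennreal e \<longleftrightarrow> near x r (e * r) A B"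
  using assms by (simp add: walkup_wets_dist_def ennreal_divide_le_iff near_def half_near_iff_excess)

text \<open>
  The infimum need not be attained, hence the quantification over all \<open>e > \<epsilon>\<close>.
\<close>

lemma approximability_le_iff:
  assumes "r > 0" "\<epsilon> \<ge> 0"
  shows "approximability \<S> A x r \<le> ennreal \<epsilon> \<longleftrightarrow>
           (\<forall>e>\<epsilon>. \<exists>S\<in>\<S>. near x r (e * r) A ((\<lambda>y. x + y) ` S))"
    (is "?L \<longleftrightarrow> ?R")
proof
  assume L: ?L
  show ?R
  proof (intro allI impI)
    fix e assume "e > \<epsilon>"
    with L assms have "approximability \<S> A x r < ennreal e"
      by (meson ennreal_lessI le_less_trans order_le_less_trans)
    then obtain S where "S \<in> \<S>" "walkup_wets_dist x r A ((\<lambda>y. x + y) ` S) < ennreal e"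
      unfolding approximability_def by (auto simp: INF_less_iff)
    with assms \<open>e > \<epsilon>\<close> show "\<exists>S\<in>\<S>. near x r (e * r) A ((\<lambda>y. x + y) ` S)"
      by (metis less_imp_le order.trans walkup_wets_dist_le_iff)
  qed
next
  assume R: ?R
  show ?L
  proof (rule ennreal_le_epsilon)
    fix d :: real assume "d > 0"
    then obtain S where "S \<in> \<S>" "near x r ((\<epsilon> + d) * r) A ((\<lambda>y. x + y) ` S)"
      using R by (metis less_add_same_cancel1)
    then have "approximability \<S> A x r \<le> ennreal (\<epsilon> + d)"
      unfolding approximability_def using assms \<open>d > 0\<close>
      by (intro INF_lower2[of S]) (auto simp: walkup_wets_dist_le_iff simp del: ennreal_plus)
    then show "approximability \<S> A x r \<le> ennreal \<epsilon> + ennreal d"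
      using assms \<open>d > 0\<close> by simp
  qed
qed

lemma ennreal_tendsto_0_iff:
  fixes f :: "'b \<Rightarrow> ennreal"
  shows "(f \<longlongrightarrow> 0) F \<longleftrightarrow> (\<forall>\<eta>>0. \<forall>\<^sub>F i in F. f i \<le> ennreal \<eta>)"
proof
  assume L: "(f \<longlongrightarrow> 0) F"
  show "\<forall>\<eta>>0. \<forall>\<^sub>F i in F. f i \<le> ennreal \<eta>"
  proof (intro allI impI)
    fix \<eta> :: real assume "\<eta> > 0"
    then have "\<forall>\<^sub>F i in F. f i < ennreal \<eta>"
      using order_tendstoD(2)[OF L] by simp
    then show "\<forall>\<^sub>F i in F. f i \<le> ennreal \<eta>"
      by (rule eventually_mono) simp
  qed
next
  assume R: "\<forall>\<eta>>0. \<forall>\<^sub>F i in F. f i \<le> ennreal \<eta>"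
  show "(f \<longlongrightarrow> 0) F"
  proof (rule order_tendstoI)
    fix a :: ennreal assume "0 < a"
    then obtain b where b: "0 < b" "b < a"
      using dense by blast
    then have "b < top"
      using less_le_trans[OF b(2) top_greatest] by simp
    with b have "0 < enn2real b" "ennreal (enn2real b) = b"
      by (auto simp: enn2real_positive_iff)
    then have "\<forall>\<^sub>F i in F. f i \<le> b"
      using R by metis
    then show "\<forall>\<^sub>F i in F. f i < a"
      by (rule eventually_mono) (use b in auto)
  qed auto
qed

lemma aw_converges_iff_near:
  "aw_converges As A \<longleftrightarrow> (\<forall>r>0. \<forall>\<eta>>0. \<forall>\<^sub>F i in sequentially. near 0 r \<eta> (As i) A)"
  unfolding aw_converges_def ennreal_tendsto_0_iff near_def eventually_conj_iff
  by (auto simp: half_near_iff_excess)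

text \<open>
  The triangle inequality for the localised excess. A point of \<open>B\<close> that is almost nearest to
  \<open>a \<in> A\<close> may leave the ball of radius \<open>r\<close> by a little more than \<open>\<eta>\<close>, so \<open>B\<close> must be controlled
  in a strictly larger ball.
\<close>

lemma half_near_trans:
  assumes AB: "half_near x r \<eta> A B" and BC: "half_near x \<rho> e B C"
    and "r + \<eta> < \<rho>" and "B \<noteq> {}"
  shows "half_near x r (\<eta> + e) A C"
  unfolding half_near_def
proof
  fix a assume a: "a \<in> A \<inter> cball x r"
  show "infdist a C \<le> \<eta> + e"
  proof (rule field_le_epsilon)
    fix \<kappa> :: real assume "\<kappa> > 0"
    define m where "m = min \<kappa> (\<rho> - (r + \<eta>))"
    have "m > 0"
      using \<open>\<kappa> > 0\<close> assms(3) by (simp add: m_def)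
    have "infdist a B \<le> \<eta>"
      using AB a by (auto simp: half_near_def)
    then obtain b where b: "b \<in> B" "dist a b < \<eta> + m"
      using \<open>B \<noteq> {}\<close> \<open>m > 0\<close> cINF_less_iff[of B "dist a" "\<eta> + m"]
      by (auto simp: infdist_notempty)
    have "dist x b \<le> dist x a + dist a b"
      by (rule dist_triangle)
    then have "b \<in> cball x \<rho>"
      using a b by (auto simp: m_def)
    then have "infdist b C \<le> e"
      using BC b by (auto simp: half_near_def)
    then show "infdist a C \<le> \<eta> + e + \<kappa>"
      using infdist_triangle[of a C b] b by (simp add: m_def)
  qed
qed

lemma near_trans:
  assumes "near x \<rho> \<eta> A B" "near x R e A C"
    and "r + \<eta> < R" "r + e < \<rho>" "0 \<le> \<eta>" "0 \<le> e" "A \<noteq> {}"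
  shows "near x r (\<eta> + e) B C"
proof -
  have "half_near x r (\<eta> + e) B C"
    using assms by (intro half_near_trans[of x r \<eta> B A R e C])
      (auto simp: near_def intro: half_near_mono)
  moreover have "half_near x r (e + \<eta>) C B"
    using assms by (intro half_near_trans[of x r e C A \<rho> \<eta> B])
      (auto simp: near_def intro: half_near_mono)
  ultimately show ?thesis
    by (simp add: near_def add.commute)
qed

text \<open>
  The radii and the tolerance depend on the three numbers only, not on the sets, so that the lemma
  applies to a whole sequence of blow-ups at once, in the role of \<open>A\<close> as well as of \<open>B\<close>.
\<close>

lemma approximability_transfer:
  fixes \<S> :: "'a::real_normed_vector set set"
  assumes "0 \<le> \<epsilon>" "\<epsilon> < e" "0 < r"
  obtains R \<rho> \<eta> where "R > 0" "\<rho> > 0" "\<eta> > 0"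
    "\<And>A B :: 'a set. \<lbrakk>A \<noteq> {}; near 0 \<rho> \<eta> A B; approximability \<S> A 0 R \<le> ennreal \<epsilon>\<rbrakk>
           \<Longrightarrow> approximability \<S> B 0 r \<le> ennreal e"
proof -
  \<comment> \<open>The gap between \<open>\<epsilon>\<close> and \<open>e\<close> is spent twice: half of it because the infimum over \<open>\<S>\<close> is not
    attained, and the other half on the growth of the radius from \<open>r\<close> to \<open>r + d\<close> together with the
    tolerance \<open>d / 2\<close>. Hence \<open>d\<close> solves \<open>(c + 1) * d = (e - c) * r\<close>.\<close>
  define c where "c = (\<epsilon> + e) / 2"
  have c: "\<epsilon> < c" "c < e" "0 \<le> c"
    using assms by (auto simp: c_def)
  define d where "d = (e - c) * r / (c + 1)"
  have "d > 0"
    unfolding d_def using c assms by simp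
  have "(c + 1) * d = (e - c) * r"
    unfolding d_def using c by simp
  then have cd: "d / 2 + c * (r + d) \<le> e * r"
    using \<open>d > 0\<close> by (simp add: algebra_simps)
  \<comment> \<open>Points of the approximating set in the ball of radius \<open>r\<close> have points of \<open>A\<close> within about
    \<open>c * (r + d)\<close>, which may lie this far outside the ball and must still be close to \<open>B\<close>.\<close>
  define \<rho> where "\<rho> = r + c * (r + d) + 1"
  show thesis
  proof (rule that[of "r + d" \<rho> "d / 2"])
    show "r + d > 0" "d / 2 > 0"
      using assms \<open>d > 0\<close> by auto
    show "\<rho> > 0"
      unfolding \<rho>_def using assms \<open>d > 0\<close> c by (intro add_nonneg_pos add_nonneg_nonneg) auto
    fix A B :: "'a set"
    assume A: "A \<noteq> {}" "near 0 \<rho> (d / 2) A B" and appr: "approximability \<S> A 0 (r + d) \<le> ennreal \<epsilon>"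
    have "\<exists>S\<in>\<S>. near 0 (r + d) (c * (r + d)) A ((\<lambda>y. 0 + y) ` S)"
      using appr c assms \<open>d > 0\<close> by (subst (asm) approximability_le_iff) auto
    then obtain S where S: "S \<in> \<S>" "near 0 (r + d) (c * (r + d)) A S"
      by auto
    have "near 0 r (d / 2 + c * (r + d)) B S"
      using \<open>d > 0\<close> c assms by (intro near_trans[OF A(2) S(2) _ _ _ _ A(1)]) (auto simp: \<rho>_def)
    then have "near 0 r (e * r) B S"
      using cd by (rule near_mono[OF _ order_refl])
    moreover have "near 0 r (e' * r) B S" if "e' > e" "near 0 r (e * r) B S" for e'
      using that assms by (auto intro: near_mono)
    ultimately show "approximability \<S> B 0 r \<le> ennreal e"
      using S assms by (subst approximability_le_iff) auto
  qed
qed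

section \<open>Rescaling about a point\<close>

definition blowup :: "'a::real_normed_vector \<Rightarrow> real \<Rightarrow> 'a set \<Rightarrow> 'a set" where
  "blowup x s A = (\<lambda>y. (y - x) /\<^sub>R s) ` A"

lemma zero_in_blowup_iff: "s > 0 \<Longrightarrow> 0 \<in> blowup x s A \<longleftrightarrow> x \<in> A"
  by (auto simp: blowup_def image_iff)

lemma blowup_blowup:
  assumes "s > 0"
  shows "blowup v 1 (blowup x s A) = blowup (x + s *\<^sub>R v) s A"
  using assms unfolding blowup_def image_image by (intro image_cong) (auto simp: algebra_simps)

lemma closure_blowup: "closure (blowup x s A) = blowup x s (closure A)"
proof -
  have "blowup x s B = (*\<^sub>R) (inverse s) ` (+) (- x) ` B" for B
    unfolding blowup_def image_image by (intro image_cong) auto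
  then show ?thesis
    by (simp only: closure_scaleR[symmetric] closure_translation)
qed

lemma infdist_image_le:
  assumes "\<And>a b. dist (f a) (f b) \<le> c * dist a b" "c > 0"
  shows "infdist (f x) (f ` A) \<le> c * infdist x A"
proof (cases "A = {}")
  case False
  have "infdist (f x) (f ` A) / c \<le> dist x a" if "a \<in> A" for a
    using infdist_le[of "f a" "f ` A" "f x"] assms(1)[of x a] assms(2) that
    by (simp add: pos_divide_le_eq mult.commute)
  then have "infdist (f x) (f ` A) / c \<le> infdist x A"
    using False by (auto simp: infdist_notempty intro: cINF_greatest)
  then show ?thesis
    using assms(2) by (simp add: pos_divide_le_eq mult.commute)
qed (simp add: infdist_def)

lemma infdist_blowup:
  assumes "s > 0"
  shows "infdist ((y - x) /\<^sub>R s) (blowup x s A) = infdist y A / s"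
proof (rule antisym)
  have "dist ((a - x) /\<^sub>R s) ((b - x) /\<^sub>R s) = inverse s * dist a b" for a b
    using assms by (simp add: dist_norm flip: scaleR_diff_right)
  then show "infdist ((y - x) /\<^sub>R s) (blowup x s A) \<le> infdist y A / s"
    unfolding blowup_def using infdist_image_le[of "\<lambda>y. (y - x) /\<^sub>R s" "inverse s" y A] assms
    by (simp add: divide_inverse mult.commute)
  define g where "g = (\<lambda>z. x + s *\<^sub>R z)"
  have "dist (g a) (g b) = s * dist a b" for a b
    using assms by (simp add: g_def dist_norm flip: scaleR_diff_right)
  moreover have "g ((z - x) /\<^sub>R s) = z" for z
    using assms by (simp add: g_def)
  ultimately have "infdist y A \<le> s * infdist ((y - x) /\<^sub>R s) (blowup x s A)"
    using infdist_image_le[of g s "(y - x) /\<^sub>R s" "blowup x s A"] assms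
    by (simp add: blowup_def image_image)
  then show "infdist y A / s \<le> infdist ((y - x) /\<^sub>R s) (blowup x s A)"
    using assms by (simp add: pos_divide_le_eq mult.commute)
qed

lemma half_near_blowup:
  assumes "s > 0"
  shows "half_near 0 r e (blowup x s A) (blowup x s B) \<longleftrightarrow> half_near x (s * r) (s * e) A B"
proof -
  have "(a - x) /\<^sub>R s \<in> cball 0 r \<longleftrightarrow> a \<in> cball x (s * r)" for a
  proof -
    have "norm ((a - x) /\<^sub>R s) = norm (a - x) / s"
      using assms by (simp add: divide_inverse mult.commute)
    then show ?thesis
      using assms by (simp add: dist_norm norm_minus_commute pos_divide_le_eq mult.commute)
  qed
  moreover have "infdist ((a - x) /\<^sub>R s) (blowup x s B) \<le> e \<longleftrightarrow> infdist a B \<le> s * e" for a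
    using assms by (simp add: infdist_blowup pos_divide_le_eq mult.commute)
  ultimately show ?thesis
    unfolding half_near_def blowup_def[of x s A] by fastforce
qed

lemma near_blowup:
  assumes "s > 0"
  shows "near 0 r e (blowup x s A) (blowup x s B) \<longleftrightarrow> near x (s * r) (s * e) A B"
  using assms by (simp add: near_def half_near_blowup)

text \<open>
  The blow-up map turns \<open>x + s S\<close> into \<open>S\<close>, and both \<open>S \<mapsto> s S\<close> and its inverse preserve the class.
\<close>

lemma approximability_blowup_le_iff:
  assumes \<S>: "local_approximation_class \<S>" and "s > 0" "r > 0" "\<epsilon> \<ge> 0"
  shows "approximability \<S> (blowup x s A) 0 r \<le> ennreal \<epsilon> \<longleftrightarrow>
         approximability \<S> A x (s * r) \<le> ennreal \<epsilon>"
proof -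
  have eq: "blowup x s ((\<lambda>y. x + y) ` (\<lambda>y. s *\<^sub>R y) ` S) = S" for S
    using \<open>s > 0\<close> by (simp add: blowup_def image_image)
  have *: "near 0 r (e * r) (blowup x s A) S \<longleftrightarrow>
      near x (s * r) (e * (s * r)) A ((\<lambda>y. x + y) ` (\<lambda>y. s *\<^sub>R y) ` S)" for e S
    using near_blowup[of s r "e * r" x A "(\<lambda>y. x + y) ` (\<lambda>y. s *\<^sub>R y) ` S"] \<open>s > 0\<close>
    by (simp only: eq) (simp add: mult.left_commute)
  have scale: "(\<lambda>y. c *\<^sub>R y) ` S \<in> \<S>" if "S \<in> \<S>" "c > 0" for S c
    using \<S> that by (auto simp: local_approximation_class_def)
  have "(\<exists>S\<in>\<S>. near 0 r (e * r) (blowup x s A) S) \<longleftrightarrow>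
        (\<exists>S\<in>\<S>. near x (s * r) (e * (s * r)) A ((\<lambda>y. x + y) ` S))" for e
  proof
    assume "\<exists>S\<in>\<S>. near 0 r (e * r) (blowup x s A) S"
    then show "\<exists>S\<in>\<S>. near x (s * r) (e * (s * r)) A ((\<lambda>y. x + y) ` S)"
      unfolding * using scale \<open>s > 0\<close> by blast
  next
    assume "\<exists>S\<in>\<S>. near x (s * r) (e * (s * r)) A ((\<lambda>y. x + y) ` S)"
    then obtain S where S: "S \<in> \<S>" "near x (s * r) (e * (s * r)) A ((\<lambda>y. x + y) ` S)"
      by blast
    have "(\<lambda>y. s *\<^sub>R y) ` (\<lambda>y. inverse s *\<^sub>R y) ` S = S"
      using \<open>s > 0\<close> by (simp add: image_image)
    with S have "near 0 r (e * r) (blowup x s A) ((\<lambda>y. inverse s *\<^sub>R y) ` S)"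
      unfolding * by simp
    then show "\<exists>S\<in>\<S>. near 0 r (e * r) (blowup x s A) S"
      using scale[of S "inverse s"] S \<open>s > 0\<close> by auto
  qed
  then show ?thesis
    using assms by (simp add: approximability_le_iff)
qed

section \<open>Attouch-Wets limits under closures and translations\<close>

lemma infdist_closure:
  "infdist x (closure A) = infdist x A"
  by (simp add: infdist_eq_setdist)

lemma half_near_closure:
  assumes "half_near x \<rho> e A B" "r < \<rho>"
  shows "half_near x r e (closure A) B"
  unfolding half_near_def
proof
  fix a assume a: "a \<in> closure A \<inter> cball x r"
  show "infdist a B \<le> e"
  proof (rule field_le_epsilon)
    fix \<kappa> :: real assume "\<kappa> > 0"
    then obtain b where b: "b \<in> A" "dist b a < min \<kappa> (\<rho> - r)"
      using a \<open>r < \<rho>\<close> closure_approachable[of a A] by (metis IntD1 diff_gt_0_iff_gt min_less_iff_conj)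
    have "dist x b \<le> dist x a + dist a b"
      by (rule dist_triangle)
    then have "b \<in> cball x \<rho>"
      using a b by (auto simp: dist_commute)
    then have "infdist b B \<le> e"
      using b assms by (auto simp: half_near_def)
    then show "infdist a B \<le> e + \<kappa>"
      using infdist_triangle[of a B b] b by (simp add: dist_commute)
  qed
qed

lemma aw_converges_closure_iff:
  "aw_converges (\<lambda>i. closure (As i)) B \<longleftrightarrow> aw_converges As B"
proof
  have "near 0 r \<eta> A B" if "near 0 r \<eta> (closure A) B" for r \<eta> and A :: "'a set"
    using that closure_subset[of A] by (auto simp: near_def half_near_def infdist_closure)
  then show "aw_converges (\<lambda>i. closure (As i)) B \<Longrightarrow> aw_converges As B"
    unfolding aw_converges_iff_near by (blast intro: eventually_mono)
next
  have *: "near 0 r \<eta> (closure A) B" if "near 0 (r + 1) \<eta> A B" for r \<eta> and A :: "'a set"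
    using that half_near_closure[of 0 "r + 1" \<eta> A B r] half_near_mono[of 0 "r + 1" \<eta> B A r \<eta>]
    by (auto simp: near_def) (auto simp: half_near_def infdist_closure)
  assume L: "aw_converges As B"
  show "aw_converges (\<lambda>i. closure (As i)) B"
    unfolding aw_converges_iff_near
  proof (intro allI impI)
    fix r \<eta> :: real assume "r > 0" "\<eta> > 0"
    then have "\<forall>\<^sub>F i in sequentially. near 0 (r + 1) \<eta> (As i) B"
      using L by (auto simp: aw_converges_iff_near)
    then show "\<forall>\<^sub>F i in sequentially. near 0 r \<eta> (closure (As i)) B"
      by (rule eventually_mono) (rule *)
  qed
qed

lemma half_near_translate:
  assumes "half_near 0 \<rho> e A B" "r + norm v \<le> \<rho>"
  shows "half_near 0 r (e + norm (v - w)) (blowup v 1 A) (blowup w 1 B)"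
  unfolding half_near_def blowup_def[of v 1 A]
proof safe
  fix a assume a: "a \<in> A" "(a - v) /\<^sub>R 1 \<in> cball 0 r"
  then have "norm a \<le> \<rho>"
    using norm_triangle_ineq2[of a v] assms(2) by simp
  then have "infdist a B \<le> e"
    using a assms by (auto simp: half_near_def)
  moreover have "infdist ((a - w) /\<^sub>R 1) (blowup w 1 B) = infdist a B"
    by (subst infdist_blowup) auto
  moreover have "dist ((a - v) /\<^sub>R 1) ((a - w) /\<^sub>R 1) = norm (v - w)"
    by (simp add: dist_norm norm_minus_commute)
  ultimately show "infdist ((a - v) /\<^sub>R 1) (blowup w 1 B) \<le> e + norm (v - w)"
    using infdist_triangle[of "(a - v) /\<^sub>R 1" "blowup w 1 B" "(a - w) /\<^sub>R 1"] by simp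
qed

text \<open>
  The translation vectors may vary along the sequence; this is what allows the centres of a
  sequence of blow-ups to be moved by amounts comparable to the scales.
\<close>

lemma aw_converges_translate:
  assumes "aw_converges As B" "vs \<longlonglongrightarrow> v"
  shows "aw_converges (\<lambda>i. blowup (vs i) 1 (As i)) (blowup v 1 B)"
  unfolding aw_converges_iff_near
proof (intro allI impI)
  fix r \<eta> :: real assume "r > 0" "\<eta> > 0"
  define \<rho> where "\<rho> = r + norm v + 1"
  have "\<rho> > 0"
    using \<open>r > 0\<close> by (simp add: \<rho>_def add_pos_nonneg)
  then have "\<forall>\<^sub>F i in sequentially. near 0 \<rho> (\<eta> / 2) (As i) B"
    using assms(1) \<open>\<eta> > 0\<close> by (auto simp: aw_converges_iff_near)
  moreover have "\<forall>\<^sub>F i in sequentially. dist (vs i) v < min 1 (\<eta> / 2)"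
    using assms(2) \<open>\<eta> > 0\<close> by (intro tendstoD) auto
  ultimately show "\<forall>\<^sub>F i in sequentially. near 0 r \<eta> (blowup (vs i) 1 (As i)) (blowup v 1 B)"
  proof eventually_elim
    case (elim i)
    then have d: "norm (vs i - v) < 1" "norm (v - vs i) \<le> \<eta> / 2" "norm (vs i - v) \<le> \<eta> / 2"
      by (auto simp: dist_norm norm_minus_commute)
    have "norm (vs i) \<le> norm v + 1"
      using norm_triangle_ineq2[of "vs i" v] d by simp
    then have "half_near 0 r (\<eta> / 2 + norm (vs i - v)) (blowup (vs i) 1 (As i)) (blowup v 1 B)"
      "half_near 0 r (\<eta> / 2 + norm (v - vs i)) (blowup v 1 B) (blowup (vs i) 1 (As i))"
      using elim(1) by (auto simp: near_def \<rho>_def intro!: half_near_translate[of \<rho>])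
    then show ?case
      using d unfolding near_def by (auto intro: half_near_mono)
  qed
qed

section \<open>Compactness of the sets through the origin\<close>

text \<open>
  The distance functions \<open>x \<mapsto> infdist x (As n)\<close> are 1-Lipschitz and bounded by \<open>norm x\<close>, as all
  sets contain the origin. By a diagonal argument, a subsequence of them converges at each point of
  a countable dense set. The limit set consists of the points at which this subsequence tends to 0.
\<close>

lemma aw_compact:
  fixes As :: "nat \<Rightarrow> 'a::euclidean_space set"
  assumes zero: "\<And>i. 0 \<in> As i"
  obtains T k where "T \<in> closed_zero_sets" "strict_mono (k :: nat \<Rightarrow> nat)"
    "aw_converges (\<lambda>i. As (k i)) T"
proof -
  obtain D :: "'a set" where D: "countable D" "\<And>X. open X \<Longrightarrow> X \<noteq> {} \<Longrightarrow> \<exists>d\<in>D. d \<in> X"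
    using countable_dense_setE by blast
  \<comment> \<open>Dividing by \<open>norm x + 1\<close> makes the distance functions uniformly bounded, as the diagonal
    argument requires.\<close>
  have bound: "norm (infdist x (As n) / (norm x + 1)) \<le> 1" for n x
    using infdist_le[OF zero, of x n] infdist_nonneg[of x "As n"]
    by (simp add: divide_simps add_nonneg_pos dist_norm)
  obtain k :: "nat \<Rightarrow> nat" where k: "strict_mono k"
    and conv: "\<And>x. x \<in> D \<Longrightarrow> \<exists>l. (\<lambda>n. infdist x (As (k n)) / (norm x + 1)) \<longlonglongrightarrow> l"
    using function_convergent_subsequence[of D "\<lambda>n x. infdist x (As n) / (norm x + 1)" 1, OF D(1) bound]
    by metis
  define f where "f n x = infdist x (As (k n))" for n x
  have f0: "f n x \<ge> 0" for n x
    by (simp add: f_def infdist_nonneg)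
  have lip: "f n x \<le> f n y + dist x y" for n x y
    unfolding f_def by (rule infdist_triangle)
  have convD: "convergent (\<lambda>n. f n d)" if d: "d \<in> D" for d
  proof -
    have "convergent (\<lambda>n. infdist d (As (k n)) / (norm d + 1))"
      using conv[OF d] by (auto simp: convergent_def)
    then obtain l where "(\<lambda>n. infdist d (As (k n)) / (norm d + 1)) \<longlonglongrightarrow> l"
      by (auto simp: convergent_def)
    then have "(\<lambda>n. (norm d + 1) * (infdist d (As (k n)) / (norm d + 1))) \<longlonglongrightarrow> (norm d + 1) * l"
      by (intro tendsto_intros)
    moreover have "norm d + 1 \<noteq> 0"
      by (smt (verit) norm_ge_zero)
    ultimately show ?thesis
      by (auto simp: convergent_def f_def)
  qed
  define T where "T = {x. \<forall>\<eta>>0. \<forall>\<^sub>F n in sequentially. f n x < \<eta>}"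
  have "closed T"
    unfolding closure_subset_eq[symmetric]
  proof
    fix x assume "x \<in> closure T"
    then have x: "\<forall>e>0. \<exists>y\<in>T. dist y x < e"
      by (simp add: closure_approachable)
    show "x \<in> T"
      unfolding T_def
    proof (intro CollectI allI impI)
      fix \<eta> :: real assume "\<eta> > 0"
      then obtain y where y: "y \<in> T" "dist y x < \<eta> / 2"
        using x half_gt_zero by blast
      then have "\<forall>\<^sub>F n in sequentially. f n y < \<eta> / 2"
        using \<open>\<eta> > 0\<close> half_gt_zero unfolding T_def by blast
      then show "\<forall>\<^sub>F n in sequentially. f n x < \<eta>"
      proof (rule eventually_mono)
        fix n assume "f n y < \<eta> / 2"
        with lip[of n x y] y show "f n x < \<eta>"
          by (simp add: dist_commute)
      qed
    qed
  qed
  have "0 \<in> T"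
    unfolding T_def f_def using zero by simp
  \<comment> \<open>A finite net of the compact set \<open>T \<inter> cball 0 r\<close> and the Lipschitz bound make the convergence
    of \<open>f n\<close> to 0 uniform there.\<close>
  have upper: "\<forall>\<^sub>F n in sequentially. half_near 0 r \<eta> T (As (k n))" if "\<eta> > 0" for r \<eta>
  proof -
    have "compact (T \<inter> cball 0 r)"
      using \<open>closed T\<close> by (rule closed_Int_compact) simp
    moreover have "T \<inter> cball 0 r \<subseteq> (\<Union>c\<in>T. ball c (\<eta> / 2))"
      using \<open>\<eta> > 0\<close> by (auto intro!: exI)
    ultimately obtain F where F: "F \<subseteq> T" "finite F" "T \<inter> cball 0 r \<subseteq> (\<Union>c\<in>F. ball c (\<eta> / 2))"
      using compactE_image[of "T \<inter> cball 0 r" T "\<lambda>c. ball c (\<eta> / 2)"] open_ball by metis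
    have "\<forall>\<^sub>F n in sequentially. \<forall>c\<in>F. f n c < \<eta> / 2"
      using F \<open>\<eta> > 0\<close> half_gt_zero[of \<eta>]
      by (intro eventually_ball_finite) (auto simp: T_def simp del: half_gt_zero_iff less_divide_eq_numeral1)
    then show ?thesis
    proof (rule eventually_mono)
      fix n assume n: "\<forall>c\<in>F. f n c < \<eta> / 2"
      show "half_near 0 r \<eta> T (As (k n))"
        unfolding half_near_def
      proof
        fix t assume "t \<in> T \<inter> cball 0 r"
        then obtain c where "c \<in> F" "dist c t < \<eta> / 2"
          using F(3) by fastforce
        then show "infdist t (As (k n)) \<le> \<eta>"
          using n lip[of n t c] by (force simp: f_def dist_commute)
      qed
    qed
  qed
  \<comment> \<open>Otherwise infinitely many sets contain points in the ball that stay away from \<open>T\<close>. These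
    points accumulate at some \<open>l\<close>, and \<open>l\<close> belongs to \<open>T\<close>.\<close>
  have lower: "\<forall>\<^sub>F n in sequentially. half_near 0 r \<eta> (As (k n)) T" if "\<eta> > 0" for r \<eta>
  proof (rule ccontr)
    assume "\<not> ?thesis"
    then have inf: "\<exists>\<^sub>F n in sequentially. \<not> half_near 0 r \<eta> (As (k n)) T"
      by (simp add: frequently_def)
    define N where "N = {n. \<not> half_near 0 r \<eta> (As (k n)) T}"
    have "infinite N"
      using inf unfolding N_def by (simp add: frequently_cofinite flip: cofinite_eq_sequentially)
    define m where "m = enumerate N"
    have m: "strict_mono m" "m i \<in> N" for i
      using \<open>infinite N\<close> by (auto simp: m_def strict_mono_enumerate enumerate_in_set)
    have "\<exists>a. a \<in> As (k (m i)) \<inter> cball 0 r \<and> infdist a T > \<eta>" for i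
      using m(2)[of i] by (auto simp: N_def half_near_def not_le)
    then obtain a where a: "\<And>i. a i \<in> As (k (m i))" "\<And>i. a i \<in> cball 0 r" "\<And>i. infdist (a i) T > \<eta>"
      by (metis IntD1 IntD2)
    obtain l h where h: "strict_mono (h :: nat \<Rightarrow> nat)" "(a \<circ> h) \<longlonglongrightarrow> l"
      using compact_cball[of 0 r] a(2) unfolding compact_def by metis
    have "l \<in> T"
      unfolding T_def
    proof (intro CollectI allI impI)
      fix \<delta> :: real assume "\<delta> > 0"
      then obtain d where d: "d \<in> D" "dist l d < \<delta> / 4"
        using D(2)[of "ball l (\<delta> / 4)"] by auto
      obtain L where L: "(\<lambda>n. f n d) \<longlonglongrightarrow> L"
        using convD[OF d(1)] by (auto simp: convergent_def)
      \<comment> \<open>That \<open>f n l\<close> gets small is clear only along the sub-subsequence \<open>m (h i)\<close>; membership in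
        \<open>T\<close> needs it for all large \<open>n\<close>. Convergence at the nearby point \<open>d\<close> of the dense set
        bridges this gap, as a limit can be computed along any subsequence.\<close>
      have "L \<le> \<delta> / 4"
      proof (rule tendsto_le)
        show "(\<lambda>i. f (m (h i)) d) \<longlonglongrightarrow> L"
          using LIMSEQ_subseq_LIMSEQ[OF LIMSEQ_subseq_LIMSEQ[OF L m(1)] h(1)] by (simp add: o_def)
        show "(\<lambda>i. \<delta> / 4 + dist l ((a \<circ> h) i)) \<longlonglongrightarrow> \<delta> / 4"
          using tendsto_add[OF tendsto_const tendsto_dist[OF tendsto_const h(2)], of "\<delta> / 4" l] by simp
        have "f (m (h i)) d \<le> \<delta> / 4 + dist l ((a \<circ> h) i)" for i
        proof -
          have "f (m (h i)) ((a \<circ> h) i) = 0"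
            using a(1)[of "h i"] by (simp add: f_def)
          then show ?thesis
            using lip[of "m (h i)" d "(a \<circ> h) i"] dist_triangle[of d "(a \<circ> h) i" l] d
            by (simp add: dist_commute)
        qed
        then show "\<forall>\<^sub>F i in sequentially. f (m (h i)) d \<le> \<delta> / 4 + dist l ((a \<circ> h) i)"
          by simp
      qed simp
      then have "\<forall>\<^sub>F n in sequentially. f n d < \<delta> / 2"
        using order_tendstoD(2)[OF L, of "\<delta> / 2"] \<open>\<delta> > 0\<close> by simp
      then show "\<forall>\<^sub>F n in sequentially. f n l < \<delta>"
      proof (rule eventually_mono)
        fix n assume "f n d < \<delta> / 2"
        then show "f n l < \<delta>"
          using lip[of n l d] d \<open>\<delta> > 0\<close> by simp
      qed
    qed
    have "(\<lambda>i. infdist ((a \<circ> h) i) T) \<longlonglongrightarrow> infdist l T"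
      using h(2) by (rule tendsto_infdist)
    moreover have "\<eta> \<le> infdist ((a \<circ> h) i) T" for i
      using a(3)[of "h i"] by simp
    ultimately have "\<eta> \<le> infdist l T"
      by (intro LIMSEQ_le_const) auto
    then show False
      using \<open>l \<in> T\<close> \<open>\<eta> > 0\<close> by simp
  qed
  show thesis
  proof (rule that)
    show "T \<in> closed_zero_sets"
      using \<open>closed T\<close> \<open>0 \<in> T\<close> by (simp add: closed_zero_sets_def)
    show "aw_converges (\<lambda>i. As (k i)) T"
      unfolding aw_converges_iff_near near_def using upper lower
      by (auto intro: eventually_conj)
  qed (rule k)
qed

section \<open>Pseudotangents\<close>

lemma pseudotangents_iff:
  "T \<in> pseudotangents A x \<longleftrightarrow> T \<in> closed_zero_sets \<and>
     (\<exists>xs rs. (\<forall>i. xs i \<in> A) \<and> (\<forall>i. rs i > 0) \<and> xs \<longlonglongrightarrow> x \<and> rs \<longlonglongrightarrow> 0 \<and>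
        aw_converges (\<lambda>i. blowup (xs i) (rs i) A) T)"
  by (simp add: pseudotangents_def blowup_def)

text \<open>
  Moving the centres of the blow-ups from \<open>xs i\<close> to \<open>ys i\<close>, where the displacement measured in
  units of the scale converges to \<open>v\<close>, translates the limit by \<open>- v\<close>.
\<close>

lemma aw_converges_shift:
  assumes "aw_converges (\<lambda>i. blowup (xs i) (rs i) A) T" "\<And>i. rs i > 0"
    and "xs \<longlonglongrightarrow> x" "rs \<longlonglongrightarrow> 0" and v: "(\<lambda>i. (ys i - xs i) /\<^sub>R rs i) \<longlonglongrightarrow> v"
  shows "ys \<longlonglongrightarrow> x" "aw_converges (\<lambda>i. blowup (ys i) (rs i) A) (blowup v 1 T)"
proof -
  have ys: "xs i + rs i *\<^sub>R ((ys i - xs i) /\<^sub>R rs i) = ys i" for i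
    using assms(2)[of i] by simp
  have "(\<lambda>i. xs i + rs i *\<^sub>R ((ys i - xs i) /\<^sub>R rs i)) \<longlonglongrightarrow> x + 0 *\<^sub>R v"
    using assms by (intro tendsto_intros)
  then show "ys \<longlonglongrightarrow> x"
    unfolding ys by simp
  show "aw_converges (\<lambda>i. blowup (ys i) (rs i) A) (blowup v 1 T)"
    using aw_converges_translate[OF assms(1) v] by (simp only: blowup_blowup[OF assms(2)] ys)
qed

text \<open>
  Replacing centres in the closure by centres in \<open>A\<close> at distances of smaller order than the scale
  does not change the limit, and a set and its closure have the same distance functions.
\<close>

lemma pseudotangents_closure: "pseudotangents (closure A) x = pseudotangents A x"
proof (intro equalityI subsetI)
  fix T assume "T \<in> pseudotangents A x"
  then show "T \<in> pseudotangents (closure A) x"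
    unfolding pseudotangents_iff closure_blowup[symmetric] aw_converges_closure_iff
    using closure_subset by blast
next
  fix T assume "T \<in> pseudotangents (closure A) x"
  then obtain xs rs where T: "T \<in> closed_zero_sets" and xs: "\<And>i. xs i \<in> closure A" "\<And>i. rs i > 0"
    "xs \<longlonglongrightarrow> x" "rs \<longlonglongrightarrow> 0" "aw_converges (\<lambda>i. blowup (xs i) (rs i) A) T"
    unfolding pseudotangents_iff closure_blowup[symmetric] aw_converges_closure_iff by blast
  have "\<exists>y\<in>A. dist y (xs i) < rs i * inverse (real (Suc i))" for i
    using xs(1,2)[of i] by (auto simp: closure_approachable)
  then obtain ys where ys: "\<And>i. ys i \<in> A" "\<And>i. dist (ys i) (xs i) < rs i * inverse (real (Suc i))"
    by metis
  have "norm ((ys i - xs i) /\<^sub>R rs i) \<le> inverse (real (Suc i))" for i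
  proof -
    have "norm ((ys i - xs i) /\<^sub>R rs i) = norm (ys i - xs i) / rs i"
      using xs(2)[of i] by (simp add: divide_inverse mult.commute)
    then show ?thesis
      using ys(2)[of i] xs(2)[of i] by (simp add: dist_norm pos_divide_le_eq mult.commute)
  qed
  then have v: "(\<lambda>i. (ys i - xs i) /\<^sub>R rs i) \<longlonglongrightarrow> 0"
    by (intro Lim_null_comparison[OF _ LIMSEQ_inverse_real_of_nat]) simp
  have "blowup 0 1 T = T"
    by (simp add: blowup_def)
  with aw_converges_shift[OF xs(5,2,3,4) v] show "T \<in> pseudotangents A x"
    unfolding pseudotangents_iff using T ys(1) xs(2,4) by auto
qed

text \<open>
  As the blow-ups converge to \<open>T\<close>, they contain points tending to \<open>t\<close>; the corresponding points
  of \<open>A\<close> serve as new centres.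
\<close>

lemma pseudotangents_translate:
  assumes T: "T \<in> pseudotangents A x" and t: "t \<in> T"
  shows "blowup t 1 T \<in> pseudotangents A x"
proof -
  obtain xs rs where xs: "\<And>i. xs i \<in> A" "\<And>i. rs i > 0"
    "xs \<longlonglongrightarrow> x" "rs \<longlonglongrightarrow> 0" "aw_converges (\<lambda>i. blowup (xs i) (rs i) A) T"
    using T unfolding pseudotangents_iff by blast
  have "\<exists>y\<in>A. dist t ((y - xs i) /\<^sub>R rs i) < infdist t (blowup (xs i) (rs i) A) + inverse (real (Suc i))" for i
  proof -
    have "blowup (xs i) (rs i) A \<noteq> {}"
      using xs(1)[of i] by (auto simp: blowup_def)
    moreover have "infdist t (blowup (xs i) (rs i) A) < infdist t (blowup (xs i) (rs i) A) + inverse (real (Suc i))"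
      by simp
    ultimately have "\<exists>z\<in>blowup (xs i) (rs i) A. dist t z < infdist t (blowup (xs i) (rs i) A) + inverse (real (Suc i))"
      using cINF_less_iff[of "blowup (xs i) (rs i) A" "dist t"]
      by (metis bdd_below_image_dist infdist_notempty)
    then show ?thesis
      by (auto simp: blowup_def)
  qed
  then obtain ys where ys: "\<And>i. ys i \<in> A"
    "\<And>i. dist t ((ys i - xs i) /\<^sub>R rs i) < infdist t (blowup (xs i) (rs i) A) + inverse (real (Suc i))"
    by metis
  have "(\<lambda>i. infdist t (blowup (xs i) (rs i) A)) \<longlonglongrightarrow> 0"
  proof (rule tendstoI)
    fix e :: real assume "e > 0"
    then have "\<forall>\<^sub>F i in sequentially. near 0 (norm t + 1) (e / 2) (blowup (xs i) (rs i) A) T"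
      using xs(5) by (simp add: aw_converges_iff_near add_nonneg_pos)
    then show "\<forall>\<^sub>F i in sequentially. dist (infdist t (blowup (xs i) (rs i) A)) 0 < e"
    proof (rule eventually_mono)
      fix i assume "near 0 (norm t + 1) (e / 2) (blowup (xs i) (rs i) A) T"
      then have "infdist t (blowup (xs i) (rs i) A) \<le> e / 2"
        using t by (auto simp: near_def half_near_def)
      then show "dist (infdist t (blowup (xs i) (rs i) A)) 0 < e"
        using \<open>e > 0\<close> by (simp add: infdist_nonneg)
    qed
  qed
  then have "(\<lambda>i. infdist t (blowup (xs i) (rs i) A) + inverse (real (Suc i))) \<longlonglongrightarrow> 0 + 0"
    by (intro tendsto_add LIMSEQ_inverse_real_of_nat)
  moreover have "norm ((ys i - xs i) /\<^sub>R rs i - t) \<le> infdist t (blowup (xs i) (rs i) A) + inverse (real (Suc i))" for i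
    using ys(2)[of i] by (simp add: dist_norm norm_minus_commute)
  ultimately have "(\<lambda>i. (ys i - xs i) /\<^sub>R rs i - t) \<longlonglongrightarrow> 0"
    using Lim_null_comparison[OF always_eventually[OF allI]] by fastforce
  then have v: "(\<lambda>i. (ys i - xs i) /\<^sub>R rs i) \<longlonglongrightarrow> t"
    by (rule LIM_zero_cancel)
  have "closed T"
    using T by (simp add: pseudotangents_iff closed_zero_sets_def)
  then have "closure (blowup t 1 T) = blowup t 1 T"
    by (simp add: closure_blowup)
  then have "blowup t 1 T \<in> closed_zero_sets"
    using t by (simp add: closed_zero_sets_def zero_in_blowup_iff closure_eq)
  with aw_converges_shift[OF xs(5,2,3,4) v] show ?thesis
    unfolding pseudotangents_iff using ys(1) xs(2,4) by auto
qed

section \<open>Approximability of a set and of its pseudotangents\<close>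

text \<open>
  Local approximability is applied to the compact set formed by the centres of the blow-ups and
  their limit.
\<close>

lemma pseudotangents_subset_enlargement_at_zero:
  fixes A :: "'a::{real_normed_vector, heine_borel} set"
  assumes \<S>: "local_approximation_class \<S>" and "\<epsilon> \<ge> 0"
    and A: "\<And>\<epsilon>'. \<epsilon>' > \<epsilon> \<Longrightarrow> locally_approximable \<S> \<epsilon>' A" and "x \<in> A"
  shows "pseudotangents A x \<subseteq> enlargement_at_zero \<S> \<epsilon>"
proof
  fix T assume "T \<in> pseudotangents A x"
  then obtain xs rs where T: "T \<in> closed_zero_sets" and xs: "\<And>i. xs i \<in> A" "\<And>i. rs i > 0"
    "xs \<longlonglongrightarrow> x" "rs \<longlonglongrightarrow> 0" "aw_converges (\<lambda>i. blowup (xs i) (rs i) A) T"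
    unfolding pseudotangents_iff by blast
  have "compact (insert x (range xs))" "insert x (range xs) \<subseteq> A"
    using compact_sequence_with_limit[OF xs(3)] xs(1) \<open>x \<in> A\<close> by auto
  have "approximability \<S> T 0 r \<le> ennreal \<epsilon>" if "r > 0" for r
  proof (rule ennreal_le_epsilon)
    fix d :: real assume "d > 0"
    obtain R \<rho> \<eta> where pos: "R > 0" "\<rho> > 0" "\<eta> > 0"
      and transfer: "\<And>A B :: 'a set. \<lbrakk>A \<noteq> {}; near 0 \<rho> \<eta> A B;
          approximability \<S> A 0 R \<le> ennreal (\<epsilon> + d / 2)\<rbrakk> \<Longrightarrow> approximability \<S> B 0 r \<le> ennreal (\<epsilon> + d)"
      using approximability_transfer[of "\<epsilon> + d / 2" "\<epsilon> + d" r \<S>] \<open>\<epsilon> \<ge> 0\<close> \<open>d > 0\<close> \<open>r > 0\<close>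
      by auto
    obtain r\<^sub>K where rK: "r\<^sub>K > 0" "\<And>y s. y \<in> insert x (range xs) \<Longrightarrow> 0 < s \<Longrightarrow> s \<le> r\<^sub>K \<Longrightarrow>
        approximability \<S> A y s \<le> ennreal (\<epsilon> + d / 2)"
      using A[of "\<epsilon> + d / 2"] \<open>d > 0\<close> \<open>compact (insert x (range xs))\<close> \<open>insert x (range xs) \<subseteq> A\<close>
      unfolding locally_approximable_def by (metis half_gt_zero less_add_same_cancel1)
    have "\<forall>\<^sub>F i in sequentially. near 0 \<rho> \<eta> (blowup (xs i) (rs i) A) T"
      using xs(5) pos by (auto simp: aw_converges_iff_near)
    moreover have "\<forall>\<^sub>F i in sequentially. rs i < r\<^sub>K / R"
      using order_tendstoD(2)[OF xs(4)] rK(1) pos by simp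
    ultimately have "\<forall>\<^sub>F i in sequentially. approximability \<S> T 0 r \<le> ennreal (\<epsilon> + d)"
    proof eventually_elim
      case (elim i)
      have "rs i * R \<le> r\<^sub>K"
        using elim(2) pos by (simp add: pos_less_divide_eq)
      then have "approximability \<S> A (xs i) (rs i * R) \<le> ennreal (\<epsilon> + d / 2)"
        using pos xs(2)[of i] by (intro rK(2)) auto
      then have "approximability \<S> (blowup (xs i) (rs i) A) 0 R \<le> ennreal (\<epsilon> + d / 2)"
        using \<S> pos xs(2)[of i] \<open>\<epsilon> \<ge> 0\<close> \<open>d > 0\<close>
          by (simp add: approximability_blowup_le_iff del: ennreal_plus)
      moreover have "blowup (xs i) (rs i) A \<noteq> {}"
        using \<open>x \<in> A\<close> by (auto simp: blowup_def)
      ultimately show ?case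
        using elim(1) transfer by blast
    qed
    then show "approximability \<S> T 0 r \<le> ennreal \<epsilon> + ennreal d"
      using \<open>\<epsilon> \<ge> 0\<close> \<open>d > 0\<close> by simp
  qed
  with T show "T \<in> enlargement_at_zero \<S> \<epsilon>"
    by (simp add: enlargement_at_zero_def)
qed

text \<open>
  A failure of local approximability produces bad blow-ups at points of a compact \<open>K \<subseteq> A\<close>. It
  matters that the points accumulate inside \<open>K\<close>: nothing is assumed about pseudotangents at points
  outside \<open>A\<close>.
\<close>

lemma locally_approximable_if_pseudotangents:
  fixes A :: "'a::euclidean_space set"
  assumes \<S>: "local_approximation_class \<S>" and "\<epsilon> \<ge> 0" and "\<epsilon>' > \<epsilon>"
    and A: "\<And>x. x \<in> A \<Longrightarrow> pseudotangents A x \<subseteq> enlargement_at_zero \<S> \<epsilon>"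
  shows "locally_approximable \<S> \<epsilon>' A"
  unfolding locally_approximable_def
proof (intro allI impI, rule ccontr)
  fix K :: "'a set" assume K: "compact K \<and> K \<subseteq> A"
  assume "\<not> (\<exists>r\<^sub>K>0. \<forall>x\<in>K. \<forall>r. 0 < r \<and> r \<le> r\<^sub>K \<longrightarrow> approximability \<S> A x r \<le> ennreal \<epsilon>')"
  then have "\<exists>x r. x \<in> K \<and> 0 < r \<and> r \<le> inverse (real (Suc i)) \<and>
      \<not> approximability \<S> A x r \<le> ennreal \<epsilon>'" for i
    by (metis inverse_positive_iff_positive of_nat_0_less_iff zero_less_Suc)
  then obtain xs rs where xs: "\<And>i. xs i \<in> K" "\<And>i. 0 < rs i" "\<And>i. rs i \<le> inverse (real (Suc i))"
    and bad: "\<And>i. \<not> approximability \<S> A (xs i) (rs i) \<le> ennreal \<epsilon>'"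
    by metis
  have rs: "rs \<longlonglongrightarrow> 0"
    by (rule tendsto_sandwich[OF _ _ tendsto_const LIMSEQ_inverse_real_of_nat])
      (use xs(2,3) in \<open>auto intro: always_eventually less_imp_le\<close>)
  obtain x k where "x \<in> K" and k: "strict_mono (k :: nat \<Rightarrow> nat)" "(xs \<circ> k) \<longlonglongrightarrow> x"
    using K xs(1) unfolding compact_def by metis
  have "0 \<in> blowup (xs (k i)) (rs (k i)) A" for i
    using xs(1,2)[of "k i"] K by (auto simp: zero_in_blowup_iff)
  then obtain T h where T: "T \<in> closed_zero_sets" and h: "strict_mono (h :: nat \<Rightarrow> nat)"
    and lim: "aw_converges (\<lambda>i. blowup (xs (k (h i))) (rs (k (h i))) A) T"
    by (rule aw_compact[of "\<lambda>i. blowup (xs (k i)) (rs (k i)) A"])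
  have "(\<lambda>i. xs (k (h i))) \<longlonglongrightarrow> x" "(\<lambda>i. rs (k (h i))) \<longlonglongrightarrow> 0"
    using LIMSEQ_subseq_LIMSEQ[OF k(2) h]
      LIMSEQ_subseq_LIMSEQ[OF LIMSEQ_subseq_LIMSEQ[OF rs k(1)] h] by (simp_all add: o_def)
  then have "T \<in> pseudotangents A x"
    unfolding pseudotangents_iff using T lim xs(1,2) K
    by (intro conjI exI[of _ "\<lambda>i. xs (k (h i))"] exI[of _ "\<lambda>i. rs (k (h i))"]) auto
  then have TR: "approximability \<S> T 0 R \<le> ennreal \<epsilon>" if "R > 0" for R
    using A \<open>x \<in> K\<close> K that by (auto simp: enlargement_at_zero_def)
  obtain R \<rho> \<eta> where pos: "R > 0" "\<rho> > 0" "\<eta> > 0"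
    and transfer: "\<And>A B :: 'a set. \<lbrakk>A \<noteq> {}; near 0 \<rho> \<eta> A B;
        approximability \<S> A 0 R \<le> ennreal \<epsilon>\<rbrakk> \<Longrightarrow> approximability \<S> B 0 1 \<le> ennreal \<epsilon>'"
    using approximability_transfer[of \<epsilon> \<epsilon>' 1 \<S>] assms(2,3) by auto
  have "\<forall>\<^sub>F i in sequentially. near 0 \<rho> \<eta> (blowup (xs (k (h i))) (rs (k (h i))) A) T"
    using lim pos by (auto simp: aw_converges_iff_near)
  then obtain i where i: "near 0 \<rho> \<eta> T (blowup (xs (k (h i))) (rs (k (h i))) A)"
    by (auto simp: near_sym[of _ _ _ T] dest: eventually_happens)
  have "T \<noteq> {}"
    using T by (auto simp: closed_zero_sets_def)
  then have "approximability \<S> (blowup (xs (k (h i))) (rs (k (h i))) A) 0 1 \<le> ennreal \<epsilon>'"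
    using transfer i TR pos by blast
  then have "approximability \<S> A (xs (k (h i))) (rs (k (h i))) \<le> ennreal \<epsilon>'"
    using approximability_blowup_le_iff[OF \<S>, of "rs (k (h i))" 1 \<epsilon>'] xs(2) assms(2,3) by simp
  with bad show False
    by blast
qed

lemma pseudotangents_enlargement_iff:
  assumes \<S>: "local_approximation_class \<S>" and "\<epsilon> \<ge> 0"
  shows "pseudotangents A x \<subseteq> enlargement_at_zero \<S> \<epsilon> \<longleftrightarrow>
         pseudotangents A x \<subseteq> enlargement_everywhere \<S> \<epsilon>"
proof
  assume zero: "pseudotangents A x \<subseteq> enlargement_at_zero \<S> \<epsilon>"
  show "pseudotangents A x \<subseteq> enlargement_everywhere \<S> \<epsilon>"
  proof
    fix T assume T: "T \<in> pseudotangents A x"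
    have "approximability \<S> T t r \<le> ennreal \<epsilon>" if "t \<in> T" "r > 0" for t r
    proof -
      have "approximability \<S> (blowup t 1 T) 0 r \<le> ennreal \<epsilon>"
        using zero pseudotangents_translate[OF T \<open>t \<in> T\<close>] \<open>r > 0\<close>
        by (auto simp: enlargement_at_zero_def)
      then show ?thesis
        using approximability_blowup_le_iff[OF \<S>, of 1 r \<epsilon> t T] \<open>r > 0\<close> \<open>\<epsilon> \<ge> 0\<close> by simp
    qed
    then show "T \<in> enlargement_everywhere \<S> \<epsilon>"
      using T by (simp add: enlargement_everywhere_def pseudotangents_iff)
  qed
next
  have "enlargement_everywhere \<S> \<epsilon> \<subseteq> enlargement_at_zero \<S> \<epsilon>"
    by (auto simp: enlargement_everywhere_def enlargement_at_zero_def closed_zero_sets_def)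
  then show "pseudotangents A x \<subseteq> enlargement_everywhere \<S> \<epsilon> \<Longrightarrow>
      pseudotangents A x \<subseteq> enlargement_at_zero \<S> \<epsilon>"
    by blast
qed

theorem theorem4p14:
  fixes \<S> :: "(real ^ 'n) set set"
    and A :: "(real ^ 'n) set"
    and \<epsilon> :: real
  assumes "local_approximation_class \<S>"
    and "A \<noteq> {}"
    and "\<epsilon> \<ge> 0"
  shows "((\<forall>\<epsilon>'>\<epsilon>. locally_approximable \<S> \<epsilon>' A) \<longleftrightarrow>
            (\<forall>x\<in>A. pseudotangents (closure A) x \<subseteq> enlargement_at_zero \<S> \<epsilon>)) \<and>
         ((\<forall>x\<in>A. pseudotangents (closure A) x \<subseteq> enlargement_at_zero \<S> \<epsilon>) \<longleftrightarrow>
            (\<forall>x\<in>A. pseudotangents (closure A) x \<subseteq> enlargement_everywhere \<S> \<epsilon>))"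
  unfolding pseudotangents_closure
  using pseudotangents_subset_enlargement_at_zero[OF assms(1,3), of A]
    locally_approximable_if_pseudotangents[OF assms(1,3), of _ A]
    pseudotangents_enlargement_iff[OF assms(1,3), of A]
  by blast

end
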